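(* Let $(\theta(x,t),v(x,t))$ be a smooth solution on $\mathbb{R}^2\times[0,T)$, $T\in(0,\infty]$, of the 2D quasi-geostrophic equation $$\frac{\partial\theta}{\partial t}+(v\cdot\nabla)\theta=0,\qquad v=-\nabla^\perp(-\Delta)^{-1/2}\theta,\qquad\theta(x,0)=\theta_0(x),$$ and let $\{X(\cdot,t)\}$ be the particle trajectory map generated by $v$. Let $\{\gamma_0(s)\}_{s\in I}$ be a level curve of $\theta_0$, which is also an integral curve of $\nabla^\perp\theta_0$, and set $\gamma(s,t)=X(\gamma_0(s),t)$. Then for each $t\in[0,T)$, $s\mapsto\gamma(s,t)$ is a level curve of $\theta(\cdot,t)$. Moreover, for all $s\in I$ and $t\in[0,T)$, $$\frac{|\nabla^\perp\theta(\gamma(s,t),t)|}{\left|\frac{\partial\gamma(s,t)}{\partial s}\right|}=\frac{|\nabla^\perp\theta_0(\gamma_0(s))|}{\left|\frac{\partial\gamma_0(s)}{\partial s}\right|}.$$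
   Context: Here $\theta=\theta(x_1,x_2,t)$ is scalar, $v=(v_1,v_2)$, and $\nabla^\perp=(-\partial_{x_2},\partial_{x_1})$. The particle trajectory map $X(\cdot,t)$ generated by $v$ is defined by $\frac{\partial X(a,t)}{\partial t}=v(X(a,t),t)$, $X(a,0)=a\in\mathbb{R}^2$; for each $t\in[0,T)$ it is a diffeomorphism of $\mathbb{R}^2$ (standing assumption). A level curve of a function is a smooth curve along which the function is constant. Integral curves are understood up to reparametrization: a smooth curve $\{\gamma(s)\}_{s\in I}$ ($I\subset\mathbb{R}$ an interval) with $\frac{\partial\gamma}{\partial s}\neq0$ on $I$ is an integral curve of a vector field $V$ if there is a function $f$ on $I$ with $f(s)\ne0$ and $\frac{\partial\gamma}{\partial s}(s)=f(s)V(\gamma(s))$ for all $s\in I$. *)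

theory Defs
  imports "HOL-Analysis.Analysis"
begin

(* Functions of class C^k on S.  Derivatives are taken within S, so that S may contain boundary
   points (S = R^2 x [0,T), or S an interval with endpoints); on convex sets with nonempty
   interior such derivatives are unique.  Requiring every directional component of the
   derivative to be C^k amounts, in finite dimension, to requiring it of the derivative. *)
primrec Ck_on :: "nat \<Rightarrow> ('a::euclidean_space) set \<Rightarrow> ('a \<Rightarrow> 'b::real_normed_vector) \<Rightarrow> bool" where
  "Ck_on 0 S f \<longleftrightarrow> continuous_on S f"
| "Ck_on (Suc k) S f \<longleftrightarrow>
     (\<exists>f'. (\<forall>x\<in>S. (f has_derivative f' x) (at x within S)) \<and> (\<forall>h. Ck_on k S (\<lambda>x. f' x h)))"

definition smooth_on :: "('a::euclidean_space) set \<Rightarrow> ('a \<Rightarrow> 'b::real_normed_vector) \<Rightarrow> bool" where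
  "smooth_on S f \<longleftrightarrow> (\<forall>k. Ck_on k S f)"

definition diffeomorphism :: "(real^2 \<Rightarrow> real^2) \<Rightarrow> bool" where
  "diffeomorphism f \<longleftrightarrow> bij f \<and> smooth_on UNIV f \<and> smooth_on UNIV (inv f)"

definition partial :: "2 \<Rightarrow> (real^2 \<Rightarrow> real) \<Rightarrow> real^2 \<Rightarrow> real" where
  "partial i f x = frechet_derivative f (at x) (axis i 1)"

definition grad :: "(real^2 \<Rightarrow> real) \<Rightarrow> real^2 \<Rightarrow> real^2" where
  "grad f x = vector [partial 1 f x, partial 2 f x]"

definition perp_grad :: "(real^2 \<Rightarrow> real) \<Rightarrow> real^2 \<Rightarrow> real^2" where
  "perp_grad f x = vector [- partial 2 f x, partial 1 f x]"

(* In two dimensions the Fourier multiplier 1/|xi| is convolution with 1/(2 pi |x|), so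
   (-Laplace)^(-1/2) f is the Riesz potential of f.  For f merely in L^2, say, that integral need
   not converge, and (-Laplace)^(-1/2) f is determined only up to an additive constant, which a
   derivative does not see.  We fix the constant by making the potential vanish at the origin: the
   kernel 1/|x-y| - 1/|y| is O(1/|y|^2) at infinity, so the integral converges absolutely for every
   locally bounded f belonging to some L^p with 1 <= p < infinity.  If the Riesz potential itself
   converges, both versions have the same perpendicular gradient: see the lemmas below. *)

definition inv_sqrt_laplacian_dom :: "(real^2 \<Rightarrow> real) \<Rightarrow> bool" where
  "inv_sqrt_laplacian_dom f \<longleftrightarrow>
     (\<forall>x. integrable lborel (\<lambda>y. (1 / norm (x - y) - 1 / norm y) * f y))"

definition inv_sqrt_laplacian :: "(real^2 \<Rightarrow> real) \<Rightarrow> real^2 \<Rightarrow> real" where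
  "inv_sqrt_laplacian f x =
     1 / (2 * pi) * (\<integral>y. (1 / norm (x - y) - 1 / norm y) * f y \<partial>lborel)"

definition riesz_potential :: "(real^2 \<Rightarrow> real) \<Rightarrow> real^2 \<Rightarrow> real" where
  "riesz_potential f x = 1 / (2 * pi) * (\<integral>y. f y / norm (x - y) \<partial>lborel)"

lemma
  assumes "\<And>x. integrable lborel (\<lambda>y. f y / norm (x - y))"
  shows inv_sqrt_laplacian_dom_if_riesz: "inv_sqrt_laplacian_dom f"
    and inv_sqrt_laplacian_eq_riesz:
      "inv_sqrt_laplacian f x = riesz_potential f x - riesz_potential f 0"
proof -
  have eq: "(1 / norm (x - y) - 1 / norm y) * f y = f y / norm (x - y) - f y / norm (0 - y)"
    for x y by (simp add: field_simps diff_divide_distrib)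
  show "inv_sqrt_laplacian_dom f"
    unfolding inv_sqrt_laplacian_dom_def eq
    using assms by (intro allI Bochner_Integration.integrable_diff)
  show "inv_sqrt_laplacian f x = riesz_potential f x - riesz_potential f 0"
    unfolding inv_sqrt_laplacian_def riesz_potential_def eq
    by (subst Bochner_Integration.integral_diff[OF assms assms]) (rule right_diff_distrib)
qed

lemma perp_grad_inv_sqrt_laplacian_eq_riesz:
  assumes "\<And>x. integrable lborel (\<lambda>y. f y / norm (x - y))"
  shows "perp_grad (inv_sqrt_laplacian f) x = perp_grad (riesz_potential f) x"
proof -
  have *: "inv_sqrt_laplacian f = (\<lambda>x. riesz_potential f x - riesz_potential f 0)"
    using inv_sqrt_laplacian_eq_riesz[OF assms] by blast
  have "((\<lambda>x. g x - c) has_derivative D) F \<longleftrightarrow> (g has_derivative D) F"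
    for g :: "real^2 \<Rightarrow> real" and c D F
    using has_derivative_add_const[of "\<lambda>x. g x - c" D F c]
      has_derivative_add_const[of g D F "- c"] by auto
  then show ?thesis
    unfolding perp_grad_def partial_def frechet_derivative_def * by simp
qed

definition time_dom :: "ereal \<Rightarrow> real set" where
  "time_dom T = {t. 0 \<le> t \<and> ereal t < T}"

definition smooth_qg_solution ::
  "ereal \<Rightarrow> (real^2 \<Rightarrow> real) \<Rightarrow> (real^2 \<Rightarrow> real \<Rightarrow> real) \<Rightarrow> (real^2 \<Rightarrow> real \<Rightarrow> real^2) \<Rightarrow> bool" where
  "smooth_qg_solution T \<theta>0 \<theta> v \<longleftrightarrow>
     smooth_on (UNIV \<times> time_dom T) (\<lambda>(x, t). \<theta> x t) \<and>
     smooth_on (UNIV \<times> time_dom T) (\<lambda>(x, t). v x t) \<and>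
     (\<forall>x. \<forall>t\<in>time_dom T.
        vector_derivative (\<theta> x) (at t within time_dom T) + v x t \<bullet> grad (\<lambda>y. \<theta> y t) x = 0) \<and>
     (\<forall>t\<in>time_dom T. inv_sqrt_laplacian_dom (\<lambda>y. \<theta> y t) \<and>
        (\<forall>x. inv_sqrt_laplacian (\<lambda>y. \<theta> y t) differentiable (at x) \<and>
             v x t = - perp_grad (inv_sqrt_laplacian (\<lambda>y. \<theta> y t)) x)) \<and>
     (\<forall>x. \<theta> x 0 = \<theta>0 x)"

definition trajectory_map ::
  "ereal \<Rightarrow> (real^2 \<Rightarrow> real \<Rightarrow> real^2) \<Rightarrow> (real^2 \<Rightarrow> real \<Rightarrow> real^2) \<Rightarrow> bool" where
  "trajectory_map T v X \<longleftrightarrow>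
     (\<forall>a. X a 0 = a) \<and>
     (\<forall>a. \<forall>t\<in>time_dom T. (X a has_vector_derivative v (X a t) t) (at t within time_dom T)) \<and>
     (\<forall>t\<in>time_dom T. diffeomorphism (\<lambda>a. X a t))"

definition level_curve :: "(real^2 \<Rightarrow> real) \<Rightarrow> real set \<Rightarrow> (real \<Rightarrow> real^2) \<Rightarrow> bool" where
  "level_curve f I \<gamma> \<longleftrightarrow> smooth_on I \<gamma> \<and> (\<exists>c. \<forall>s\<in>I. f (\<gamma> s) = c)"

definition curve_deriv :: "real set \<Rightarrow> (real \<Rightarrow> real^2) \<Rightarrow> real \<Rightarrow> real^2" where
  "curve_deriv I \<gamma> s = vector_derivative \<gamma> (at s within I)"

(* Integral curve up to reparametrization. *)
definition integral_curve :: "(real^2 \<Rightarrow> real^2) \<Rightarrow> real set \<Rightarrow> (real \<Rightarrow> real^2) \<Rightarrow> bool" where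
  "integral_curve V I \<gamma> \<longleftrightarrow>
     smooth_on I \<gamma> \<and> (\<forall>s\<in>I. curve_deriv I \<gamma> s \<noteq> 0) \<and>
     (\<exists>f. \<forall>s\<in>I. f s \<noteq> 0 \<and> curve_deriv I \<gamma> s = f s *\<^sub>R V (\<gamma> s))"

end

theory Submission
  imports Defs
begin

text \<open>
  Since \<open>\<theta>(X(a,t),t) = \<theta>\<^sub>0(a)\<close>, the chain rule and the planar identity \<open>A J A\<^sup>T = (det A) J\<close>, with
  \<open>A\<close> the Jacobian matrix of \<open>X(\<cdot>,t)\<close> at \<open>a\<close> and \<open>J\<close> the rotation by a right angle, give that \<open>A\<close>
  maps the perpendicular gradient of \<open>\<theta>\<^sub>0\<close> at \<open>a\<close> to \<open>det A\<close> times that of \<open>\<theta>(\<cdot>,t)\<close> at \<open>X(a,t)\<close>.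
  The velocity is a perpendicular gradient, hence divergence free, hence \<open>det A = 1\<close>.  So the
  perpendicular gradient is carried along by the flow exactly as the tangent vector of the curve
  is, and the two being parallel initially, the quotient of their lengths is conserved.
\<close>

subsection \<open>Functions of class C^k\<close>

lemma Ck_on_SucI:
  assumes "\<And>x. x \<in> S \<Longrightarrow> (f has_derivative f' x) (at x within S)"
    and "\<And>h. Ck_on k S (\<lambda>x. f' x h)"
  shows "Ck_on (Suc k) S f"
  using assms by auto

lemma Ck_on_SucE:
  assumes "Ck_on (Suc k) S f"
  obtains f' where "\<And>x. x \<in> S \<Longrightarrow> (f has_derivative f' x) (at x within S)"
    and "\<And>h. Ck_on k S (\<lambda>x. f' x h)"
  using assms by auto

lemma Ck_on_SucD: "Ck_on (Suc k) S f \<Longrightarrow> Ck_on k S f"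
proof (induction k arbitrary: f)
  case 0
  then show ?case
    by (auto simp: continuous_on_eq_continuous_within intro: has_derivative_continuous)
next
  case (Suc k)
  obtain f' where "\<And>x. x \<in> S \<Longrightarrow> (f has_derivative f' x) (at x within S)"
    and "\<And>h. Ck_on (Suc k) S (\<lambda>x. f' x h)"
    by (rule Ck_on_SucE[OF Suc.prems]) blast
  then show ?case
    by (intro Ck_on_SucI[of S f f'] Suc.IH)
qed

lemma Ck_on_const: "Ck_on k S (\<lambda>x. c)"
proof (induction k arbitrary: c)
  case (Suc k)
  then show ?case
    by (intro Ck_on_SucI[where f' = "\<lambda>x h. 0"]) auto
qed simp

lemma Ck_on_add: "Ck_on k S f \<Longrightarrow> Ck_on k S g \<Longrightarrow> Ck_on k S (\<lambda>x. f x + g x)"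
proof (induction k arbitrary: f g)
  case 0
  then show ?case by (auto intro: continuous_intros)
next
  case (Suc k)
  obtain f' where f: "\<And>x. x \<in> S \<Longrightarrow> (f has_derivative f' x) (at x within S)"
    and "\<And>h. Ck_on k S (\<lambda>x. f' x h)"
    by (rule Ck_on_SucE[OF Suc.prems(1)]) blast
  moreover obtain g' where g: "\<And>x. x \<in> S \<Longrightarrow> (g has_derivative g' x) (at x within S)"
    and "\<And>h. Ck_on k S (\<lambda>x. g' x h)"
    by (rule Ck_on_SucE[OF Suc.prems(2)]) blast
  ultimately show ?case
    by (intro Ck_on_SucI[where f' = "\<lambda>x h. f' x h + g' x h"] has_derivative_add Suc.IH)
qed

lemma Ck_on_sum:
  "finite B \<Longrightarrow> (\<And>b. b \<in> B \<Longrightarrow> Ck_on k S (f b)) \<Longrightarrow> Ck_on k S (\<lambda>x. \<Sum>b\<in>B. f b x)"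
  by (induction B rule: finite_induct) (auto intro: Ck_on_const Ck_on_add)

lemma Ck_on_bounded_linear:
  assumes "bounded_linear L"
  shows "Ck_on k S f \<Longrightarrow> Ck_on k S (\<lambda>x. L (f x))"
proof (induction k arbitrary: f)
  case 0
  then show ?case
    using bounded_linear.continuous_on[OF assms] by auto
next
  case (Suc k)
  obtain f' where "\<And>x. x \<in> S \<Longrightarrow> (f has_derivative f' x) (at x within S)"
    and "\<And>h. Ck_on k S (\<lambda>x. f' x h)"
    by (rule Ck_on_SucE[OF Suc.prems]) blast
  then show ?case
    by (intro Ck_on_SucI[where f' = "\<lambda>x h. L (f' x h)"] Suc.IH
        bounded_linear.has_derivative[OF assms])
qed

lemma Ck_on_scaleR: "Ck_on k S f \<Longrightarrow> Ck_on k S g \<Longrightarrow> Ck_on k S (\<lambda>x. f x *\<^sub>R g x)"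
proof (induction k arbitrary: f g)
  case 0
  then show ?case by (auto intro: continuous_intros)
next
  case (Suc k)
  obtain f' where f: "\<And>x. x \<in> S \<Longrightarrow> (f has_derivative f' x) (at x within S)"
    and f': "\<And>h. Ck_on k S (\<lambda>x. f' x h)"
    by (rule Ck_on_SucE[OF Suc.prems(1)]) blast
  obtain g' where g: "\<And>x. x \<in> S \<Longrightarrow> (g has_derivative g' x) (at x within S)"
    and g': "\<And>h. Ck_on k S (\<lambda>x. g' x h)"
    by (rule Ck_on_SucE[OF Suc.prems(2)]) blast
  show ?case
    by (intro Ck_on_SucI[where f' = "\<lambda>x h. f x *\<^sub>R g' x h + f' x h *\<^sub>R g x"]
        has_derivative_scaleR f g Ck_on_add Suc.IH f' g' Ck_on_SucD[OF Suc.prems(1)]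
        Ck_on_SucD[OF Suc.prems(2)])
qed

text \<open>Chain rule and induction on the order. The derivative of \<open>g\<close> is applied to
  a direction \<open>f' x h\<close> that itself varies with \<open>x\<close>, whereas the induction
  hypothesis concerns fixed directions; expanding \<open>f' x h\<close> in the basis reduces to
  these.\<close>

lemma Ck_on_compose:
  fixes f :: "'a::euclidean_space \<Rightarrow> 'b::euclidean_space" and g :: "'b \<Rightarrow> 'c::real_normed_vector"
  assumes "f ` S \<subseteq> U"
  shows "Ck_on k U g \<Longrightarrow> Ck_on k S f \<Longrightarrow> Ck_on k S (\<lambda>x. g (f x))"
proof (induction k arbitrary: g)
  case 0
  then show ?case using assms by (auto intro: continuous_on_compose2)
next
  case (Suc k)
  obtain g' where g: "\<And>y. y \<in> U \<Longrightarrow> (g has_derivative g' y) (at y within U)"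
    and g': "\<And>h. Ck_on k U (\<lambda>y. g' y h)"
    by (rule Ck_on_SucE[OF Suc.prems(1)]) blast
  obtain f' where f: "\<And>x. x \<in> S \<Longrightarrow> (f has_derivative f' x) (at x within S)"
    and f': "\<And>h. Ck_on k S (\<lambda>x. f' x h)"
    by (rule Ck_on_SucE[OF Suc.prems(2)]) blast
  define c where "c x h = (\<Sum>b\<in>Basis. (f' x h \<bullet> b) *\<^sub>R g' (f x) b)" for x h
  show ?case
  proof (rule Ck_on_SucI[where f' = c])
    fix x assume x: "x \<in> S"
    then have "f x \<in> U" using assms by auto
    then interpret g': bounded_linear "g' (f x)"
      using g has_derivative_bounded_linear by blast
    have "g' (f x) (\<Sum>b\<in>Basis. (f' x h \<bullet> b) *\<^sub>R b) = c x h" for h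
      by (simp only: c_def g'.sum g'.scaleR)
    then have "g' (f x) (f' x h) = c x h" for h
      by (simp only: euclidean_representation)
    moreover have "((\<lambda>x. g (f x)) has_derivative (\<lambda>h. g' (f x) (f' x h))) (at x within S)"
      using has_derivative_in_compose2[OF g assms x f[OF x]] .
    ultimately show "((\<lambda>x. g (f x)) has_derivative c x) (at x within S)" by presburger
  next
    show "Ck_on k S (\<lambda>x. c x h)" for h
      unfolding c_def
      by (intro Ck_on_sum Ck_on_scaleR Suc.IH g' Ck_on_SucD[OF Suc.prems(2)]
          Ck_on_bounded_linear[OF bounded_linear_inner_left] f' finite_Basis)
  qed
qed

subsection \<open>Symmetry of second derivatives\<close>

text \<open>The mean value theorem is applied twice: first in direction \<open>u\<close> to the
  increment of \<open>f\<close> over the step \<open>s *\<^sub>R w\<close>, then in direction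
  \<open>w\<close> to the derivative along \<open>u\<close>.\<close>

lemma second_difference_mean_value:
  fixes f :: "'a::real_normed_vector \<Rightarrow> real"
  assumes f: "\<And>y. (f has_derivative f' y) (at y)"
    and p: "\<And>y. ((\<lambda>y. f' y u) has_derivative p' y) (at y)"
    and "0 < s"
  obtains a b where "0 < a" "a < s" "0 < b" "b < s"
    "f (x + s *\<^sub>R u + s *\<^sub>R w) - f (x + s *\<^sub>R u) - f (x + s *\<^sub>R w) + f x =
      s * s * p' (x + a *\<^sub>R u + b *\<^sub>R w) w"
proof -
  have line: "((\<lambda>r. g (z + r *\<^sub>R d)) has_derivative (\<lambda>h. h * g' (z + r *\<^sub>R d) d)) (at r within A)"
    if g: "\<And>y. (g has_derivative g' y) (at y)" for g :: "'a \<Rightarrow> real" and g' z d r A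
  proof -
    interpret bounded_linear "g' (z + r *\<^sub>R d)"
      using g has_derivative_bounded_linear by blast
    have "((\<lambda>r. g (z + r *\<^sub>R d)) has_derivative (\<lambda>h. g' (z + r *\<^sub>R d) (h *\<^sub>R d))) (at r within A)"
      by (rule has_derivative_compose[OF _ g]) (auto intro!: derivative_eq_intros)
    then show ?thesis by (simp add: scaleR)
  qed
  define g where "g r = f ((x + s *\<^sub>R w) + r *\<^sub>R u) - f (x + r *\<^sub>R u)" for r
  have "(g has_derivative
      (\<lambda>h. h * f' ((x + s *\<^sub>R w) + r *\<^sub>R u) u - h * f' (x + r *\<^sub>R u) u)) (at r within {0..s})" for r
    unfolding g_def by (intro has_derivative_diff line f)
  from mvt_simple[OF \<open>0 < s\<close> this] obtain a where a: "0 < a" "a < s"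
    "g s - g 0 = s * (f' ((x + s *\<^sub>R w) + a *\<^sub>R u) u - f' (x + a *\<^sub>R u) u)"
    by (auto simp: right_diff_distrib)
  define q where "q r = f' (x + a *\<^sub>R u + r *\<^sub>R w) u" for r
  have "(q has_derivative (\<lambda>h. h * p' (x + a *\<^sub>R u + r *\<^sub>R w) w)) (at r within {0..s})" for r
    unfolding q_def by (rule line[OF p])
  from mvt_simple[OF \<open>0 < s\<close> this] obtain b where b: "0 < b" "b < s"
    "q s - q 0 = s * p' (x + a *\<^sub>R u + b *\<^sub>R w) w"
    by auto
  have "g s - g 0 = s * (q s - q 0)"
    using a(3) by (simp add: q_def algebra_simps)
  then have "g s - g 0 = s * s * p' (x + a *\<^sub>R u + b *\<^sub>R w) w"
    using b(3) by simp
  moreover have "g s - g 0 = f (x + s *\<^sub>R u + s *\<^sub>R w) - f (x + s *\<^sub>R u) - f (x + s *\<^sub>R w) + f x"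
    by (simp add: g_def algebra_simps)
  ultimately show thesis using a b that by metis
qed

text \<open>The second difference is unchanged when \<open>u\<close> and \<open>w\<close> trade
  places, so for every step \<open>s\<close> the two mixed derivatives share a value at points that
  approach \<open>x\<close> with \<open>s\<close>; continuity at \<open>x\<close> gives equality
  there.\<close>

lemma mixed_derivatives_commute:
  fixes f :: "'a::real_normed_vector \<Rightarrow> real"
  assumes f: "\<And>y. (f has_derivative f' y) (at y)"
    and p: "\<And>y. ((\<lambda>y. f' y u) has_derivative p' y) (at y)"
    and q: "\<And>y. ((\<lambda>y. f' y w) has_derivative q' y) (at y)"
    and p': "isCont (\<lambda>y. p' y w) x" and q': "isCont (\<lambda>y. q' y u) x"
  shows "p' x w = q' x u"
proof -
  have "\<exists>a b c d. 0 < a \<and> a < s \<and> 0 < b \<and> b < s \<and> 0 < c \<and> c < s \<and> 0 < d \<and> d < s \<and>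
      p' (x + a *\<^sub>R u + b *\<^sub>R w) w = q' (x + c *\<^sub>R w + d *\<^sub>R u) u" if s: "0 < s" for s :: real
  proof -
    obtain a b where ab: "0 < a" "a < s" "0 < b" "b < s"
      "f (x + s *\<^sub>R u + s *\<^sub>R w) - f (x + s *\<^sub>R u) - f (x + s *\<^sub>R w) + f x =
        s * s * p' (x + a *\<^sub>R u + b *\<^sub>R w) w"
      using second_difference_mean_value[OF f p s] by blast
    obtain c d where cd: "0 < c" "c < s" "0 < d" "d < s"
      "f (x + s *\<^sub>R w + s *\<^sub>R u) - f (x + s *\<^sub>R w) - f (x + s *\<^sub>R u) + f x =
        s * s * q' (x + c *\<^sub>R w + d *\<^sub>R u) u"
      using second_difference_mean_value[OF f q s] by blast
    have eq: "x + s *\<^sub>R w + s *\<^sub>R u = x + s *\<^sub>R u + s *\<^sub>R w" by simp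
    have "s * s * p' (x + a *\<^sub>R u + b *\<^sub>R w) w = s * s * q' (x + c *\<^sub>R w + d *\<^sub>R u) u"
      using ab(5) cd(5) unfolding eq by linarith
    then show ?thesis using ab cd s by (intro exI[of _ a] exI[of _ b] exI[of _ c] exI[of _ d]) auto
  qed
  \<comment> \<open>Steps \<open>1 / Suc n\<close> turn the intermediate points into sequences
    converging to \<open>x\<close>.\<close>
  then have "\<exists>a b c d. 0 < a \<and> a < 1 / Suc n \<and> 0 < b \<and> b < 1 / Suc n \<and> 0 < c \<and> c < 1 / Suc n \<and>
      0 < d \<and> d < 1 / Suc n \<and> p' (x + a *\<^sub>R u + b *\<^sub>R w) w = q' (x + c *\<^sub>R w + d *\<^sub>R u) u" for n :: nat
    by simp
  then obtain a b c d :: "nat \<Rightarrow> real" where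
    *: "\<And>n. 0 < a n \<and> a n < 1 / Suc n \<and> 0 < b n \<and> b n < 1 / Suc n \<and> 0 < c n \<and> c n < 1 / Suc n \<and>
      0 < d n \<and> d n < 1 / Suc n \<and>
      p' (x + a n *\<^sub>R u + b n *\<^sub>R w) w = q' (x + c n *\<^sub>R w + d n *\<^sub>R u) u"
    by metis
  have lim0: "r \<longlonglongrightarrow> 0" if "\<And>n. 0 < r n \<and> r n < 1 / real (Suc n)" for r
    by (rule tendsto_sandwich[OF _ _ tendsto_const LIMSEQ_Suc[OF lim_1_over_n]])
      (use that in \<open>auto intro!: always_eventually less_imp_le\<close>)
  have pt: "(\<lambda>n. x + r n *\<^sub>R y + s n *\<^sub>R z) \<longlonglongrightarrow> x" if "r \<longlonglongrightarrow> 0" "s \<longlonglongrightarrow> 0" for r s y z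
    using tendsto_add[OF tendsto_add[OF tendsto_const[of x] tendsto_scaleR[OF that(1) tendsto_const[of y]]]
      tendsto_scaleR[OF that(2) tendsto_const[of z]]] by simp
  have "(\<lambda>n. p' (x + a n *\<^sub>R u + b n *\<^sub>R w) w) \<longlonglongrightarrow> p' x w"
    by (rule isCont_tendsto_compose[OF p']) (use * in \<open>auto intro!: pt lim0\<close>)
  moreover have "(\<lambda>n. q' (x + c n *\<^sub>R w + d n *\<^sub>R u) u) \<longlonglongrightarrow> q' x u"
    by (rule isCont_tendsto_compose[OF q']) (use * in \<open>auto intro!: pt lim0\<close>)
  ultimately show ?thesis
    using * LIMSEQ_unique by simp
qed

subsection \<open>Dependence of trajectories on the initial point\<close>

text \<open>A Gronwall estimate: the weighted square \<open>u\<close> of the norm has nonpositive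
  derivative. Squaring keeps it differentiable where \<open>\<delta>\<close> vanishes.\<close>

lemma norm_le_exp_growth:
  fixes \<delta> :: "real \<Rightarrow> 'a::real_inner"
  assumes deriv: "\<And>\<tau>. \<tau> \<in> {0..t} \<Longrightarrow> (\<delta> has_vector_derivative \<delta>' \<tau>) (at \<tau> within {0..t})"
    and bound: "\<And>\<tau>. \<tau> \<in> {0..t} \<Longrightarrow> norm (\<delta>' \<tau>) \<le> L * norm (\<delta> \<tau>)"
    and "0 \<le> t"
  shows "norm (\<delta> t) \<le> exp (L * t) * norm (\<delta> 0)"
proof -
  define u where "u \<tau> = (\<delta> \<tau> \<bullet> \<delta> \<tau>) * exp (- 2 * L * \<tau>)" for \<tau>
  define u' where "u' \<tau> = (2 * (\<delta> \<tau> \<bullet> \<delta>' \<tau>) - 2 * L * (\<delta> \<tau> \<bullet> \<delta> \<tau>)) * exp (- 2 * L * \<tau>)" for \<tau>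
  have "(u has_derivative (\<lambda>h. h * u' \<tau>)) (at \<tau> within {0..t})" if "0 \<le> \<tau>" "\<tau> \<le> t" for \<tau>
    unfolding u_def u'_def using deriv[of \<tau>, unfolded has_vector_derivative_def] that
    by (auto intro!: derivative_eq_intros simp: fun_eq_iff inner_commute algebra_simps)
  from mvt_very_simple[OF \<open>0 \<le> t\<close> this] obtain \<xi> where \<xi>: "\<xi> \<in> {0..t}" "u t - u 0 = t * u' \<xi>"
    by auto
  have "\<delta> \<xi> \<bullet> \<delta>' \<xi> \<le> norm (\<delta> \<xi>) * norm (\<delta>' \<xi>)"
    by (rule norm_cauchy_schwarz)
  also have "\<dots> \<le> norm (\<delta> \<xi>) * (L * norm (\<delta> \<xi>))"
    by (intro mult_left_mono bound \<xi>) auto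
  finally have "\<delta> \<xi> \<bullet> \<delta>' \<xi> \<le> L * (\<delta> \<xi> \<bullet> \<delta> \<xi>)"
    by (simp add: dot_square_norm power2_eq_square mult_ac)
  then have "u' \<xi> \<le> 0"
    unfolding u'_def by (intro mult_nonpos_nonneg) auto
  then have "u t \<le> u 0"
    using \<xi>(2) \<open>0 \<le> t\<close> mult_nonneg_nonpos[of t "u' \<xi>"] by linarith
  then have "(norm (\<delta> t))\<^sup>2 * exp (- 2 * L * t) \<le> (norm (\<delta> 0))\<^sup>2"
    by (simp add: u_def dot_square_norm)
  then have "(norm (\<delta> t))\<^sup>2 * exp (- 2 * L * t) * (exp (L * t))\<^sup>2 \<le> (norm (\<delta> 0))\<^sup>2 * (exp (L * t))\<^sup>2"
    by (intro mult_right_mono) auto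
  moreover have "exp (- 2 * L * t) * (exp (L * t))\<^sup>2 = 1"
    by (simp add: power2_eq_square flip: exp_add)
  ultimately have "(norm (\<delta> t))\<^sup>2 \<le> (norm (\<delta> 0))\<^sup>2 * (exp (L * t))\<^sup>2"
    by (metis mult.assoc mult_1_right)
  then have "(norm (\<delta> t))\<^sup>2 \<le> (exp (L * t) * norm (\<delta> 0))\<^sup>2"
    by (simp add: power_mult_distrib mult.commute)
  then show ?thesis
    by (rule power2_le_imp_le) auto
qed

text \<open>A continuity argument: the bound on the derivative, assumed only while the solution stays in
  the unit ball, keeps a small enough solution from ever leaving it.\<close>

lemma norm_le_exp_growth_local:
  fixes \<delta> :: "real \<Rightarrow> 'a::real_inner"
  assumes deriv: "\<And>\<tau>. \<tau> \<in> {0..t} \<Longrightarrow> (\<delta> has_vector_derivative \<delta>' \<tau>) (at \<tau> within {0..t})"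
    and bound: "\<And>\<tau>. \<tau> \<in> {0..t} \<Longrightarrow> norm (\<delta> \<tau>) \<le> 1 \<Longrightarrow> norm (\<delta>' \<tau>) \<le> L * norm (\<delta> \<tau>)"
    and "0 \<le> L" and small: "exp (L * t) * norm (\<delta> 0) < 1" and s: "s \<in> {0..t}"
  shows "norm (\<delta> s) \<le> exp (L * t) * norm (\<delta> 0)"
proof -
  have growth: "norm (\<delta> r) \<le> exp (L * t) * norm (\<delta> 0)"
    if r: "r \<in> {0..t}" and le1: "\<And>\<tau>. \<tau> \<in> {0..r} \<Longrightarrow> norm (\<delta> \<tau>) \<le> 1" for r
  proof -
    have "norm (\<delta> r) \<le> exp (L * r) * norm (\<delta> 0)"
    proof (rule norm_le_exp_growth)
      show "(\<delta> has_vector_derivative \<delta>' \<tau>) (at \<tau> within {0..r})" if "\<tau> \<in> {0..r}" for \<tau>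
        using that r by (intro has_vector_derivative_within_subset[OF deriv]) auto
    qed (use le1 r bound in auto)
    also have "\<dots> \<le> exp (L * t) * norm (\<delta> 0)"
      using r \<open>0 \<le> L\<close> by (intro mult_right_mono) (auto intro: mult_left_mono)
    finally show ?thesis .
  qed
  have cont: "continuous_on {0..t} (\<lambda>\<tau>. norm (\<delta> \<tau>))"
    by (intro continuous_on_norm continuous_on_vector_derivative[OF deriv])
  have "1 * norm (\<delta> 0) \<le> exp (L * t) * norm (\<delta> 0)"
    using \<open>0 \<le> L\<close> s by (intro mult_right_mono) auto
  then have start: "norm (\<delta> 0) < 1"
    using small by simp
  define S where "S = {\<tau> \<in> {0..t}. norm (\<delta> \<tau>) = 1}"
  \<comment> \<open>The norm starts below 1, so by the intermediate value theorem it cannot exceed 1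
    without having equalled 1 earlier.\<close>
  have hit: "\<exists>\<sigma>\<in>S. \<sigma> \<le> \<tau>" if "\<tau> \<in> {0..t}" "1 < norm (\<delta> \<tau>)" for \<tau>
    using IVT'[of "\<lambda>\<tau>. norm (\<delta> \<tau>)" 0 1 \<tau>] that start continuous_on_subset[OF cont, of "{0..\<tau>}"]
    by (force simp: S_def)
  \<comment> \<open>At a first hitting time \<open>Inf S\<close> the norm is 1, but it stayed at
    most 1 until then, so \<open>growth\<close> bounds it by a number less than 1.\<close>
  have "S = {}"
  proof (rule ccontr)
    assume "S \<noteq> {}"
    have "closed S"
      unfolding S_def by (rule continuous_closed_preimage_constant[OF cont]) auto
    moreover have below: "bdd_below S"
      unfolding S_def by (rule bdd_belowI[of _ 0]) auto
    ultimately have Inf: "Inf S \<in> S"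
      using closed_contains_Inf \<open>S \<noteq> {}\<close> by blast
    have "norm (\<delta> \<tau>) \<le> 1" if "\<tau> \<in> {0..Inf S}" for \<tau>
    proof (rule ccontr)
      assume "\<not> norm (\<delta> \<tau>) \<le> 1"
      moreover have "\<tau> \<in> {0..t}"
        using that Inf unfolding S_def by simp
      ultimately obtain \<sigma> where \<sigma>: "\<sigma> \<in> S" "\<sigma> \<le> \<tau>"
        using hit[of \<tau>] by auto
      then have "\<tau> = \<sigma>"
        using cInf_lower[OF \<sigma>(1) below] that by auto
      then show False
        using \<sigma>(1) \<open>\<not> norm (\<delta> \<tau>) \<le> 1\<close> by (auto simp: S_def)
    qed
    then show False
      using growth[of "Inf S"] Inf small by (auto simp: S_def)
  qed
  then have "norm (\<delta> \<tau>) \<le> 1" if "\<tau> \<in> {0..t}" for \<tau>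
    using hit[OF that] by force
  then show ?thesis
    using growth[OF s] s by auto
qed

text \<open>The derivative takes values in bounded linear maps, so \<open>cont\<close> means joint
  continuity in the operator norm; this supplies bounds and moduli of continuity uniform over
  compact sets of space and time.\<close>

locale C1_field =
  fixes v :: "'a::euclidean_space \<Rightarrow> real \<Rightarrow> 'a" and D :: "'a \<times> real \<Rightarrow> 'a \<Rightarrow>\<^sub>L 'a" and t :: real
  assumes deriv: "\<And>x \<tau>. \<tau> \<in> {0..t} \<Longrightarrow> ((\<lambda>y. v y \<tau>) has_derivative D (x, \<tau>)) (at x)"
    and cont: "continuous_on (UNIV \<times> {0..t}) D"
begin

text \<open>For continuous \<open>x\<close>, a compact neighbourhood of its graph on which all
  uniform estimates are made, no global bound on the velocity gradient being assumed. Writing it as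
  the image of a product makes compactness immediate.\<close>

definition tube :: "(real \<Rightarrow> 'a) \<Rightarrow> ('a \<times> real) set" where
  "tube x = (\<lambda>(\<tau>, d). (x \<tau> + d, \<tau>)) ` ({0..t} \<times> cball 0 1)"

lemma tubeI: "\<tau> \<in> {0..t} \<Longrightarrow> norm (y - x \<tau>) \<le> 1 \<Longrightarrow> (y, \<tau>) \<in> tube x"
  unfolding tube_def by (rule image_eqI[of _ _ "(\<tau>, y - x \<tau>)"]) auto

lemma tube_subset: "tube x \<subseteq> UNIV \<times> {0..t}"
  unfolding tube_def by auto

lemma compact_tube:
  assumes "continuous_on {0..t} x"
  shows "compact (tube x)"
  unfolding tube_def split_def
  by (intro compact_continuous_image compact_Times continuous_intros
      continuous_on_compose2[OF assms]) auto

text \<open>\<open>D\<close> is bounded on the compact tube, and each time slice of the tube is a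
  convex ball, so the mean value inequality applies.\<close>

lemma lipschitz_on_tube:
  assumes "continuous_on {0..t} x"
  obtains L where "0 \<le> L"
    "\<And>\<tau> \<eta>. \<tau> \<in> {0..t} \<Longrightarrow> norm \<eta> \<le> 1 \<Longrightarrow> norm (v (x \<tau> + \<eta>) \<tau> - v (x \<tau>) \<tau>) \<le> L * norm \<eta>"
proof -
  have "bounded (D ` tube x)"
    by (intro compact_imp_bounded compact_continuous_image compact_tube assms
        continuous_on_subset[OF cont tube_subset])
  then obtain L where L: "\<And>z. z \<in> tube x \<Longrightarrow> norm (D z) \<le> L"
    by (auto simp: bounded_iff)
  \<comment> \<open>Taking \<open>max L 0\<close> covers the empty interval, for which
    \<open>L\<close> may be negative.\<close>
  have "norm (v (x \<tau> + \<eta>) \<tau> - v (x \<tau>) \<tau>) \<le> max L 0 * norm \<eta>"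
    if \<tau>: "\<tau> \<in> {0..t}" and \<eta>: "norm \<eta> \<le> 1" for \<tau> \<eta>
  proof -
    have "norm (v (x \<tau> + \<eta>) \<tau> - v (x \<tau>) \<tau>) \<le> max L 0 * norm ((x \<tau> + \<eta>) - x \<tau>)"
    proof (rule differentiable_bound[of "cball (x \<tau>) 1" "\<lambda>y. v y \<tau>" "\<lambda>y. D (y, \<tau>)"])
      show "((\<lambda>y. v y \<tau>) has_derivative D (y, \<tau>)) (at y within cball (x \<tau>) 1)" for y
        by (rule has_derivative_at_withinI[OF deriv[OF \<tau>]])
      show "onorm (D (y, \<tau>)) \<le> max L 0" if "y \<in> cball (x \<tau>) 1" for y
        using L[OF tubeI[OF \<tau>, of y]] that
        by (auto simp: norm_blinfun.rep_eq dist_norm norm_minus_commute)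
    qed (use \<eta> in \<open>auto simp: dist_norm\<close>)
    then show ?thesis by simp
  qed
  then show thesis using that by (meson max.cobounded2)
qed

text \<open>By uniform continuity of \<open>D\<close> on the tube, one radius serves all times for
  keeping the derivative within \<open>e\<close> of its value at the centre; the mean value
  inequality turns this into a linearization error.\<close>

lemma uniform_linearization:
  assumes "continuous_on {0..t} x" and "0 < e"
  obtains d where "0 < d" "\<And>\<tau> \<eta>. \<tau> \<in> {0..t} \<Longrightarrow> norm \<eta> < d \<Longrightarrow>
    norm (v (x \<tau> + \<eta>) \<tau> - v (x \<tau>) \<tau> - D (x \<tau>, \<tau>) \<eta>) \<le> e * norm \<eta>"
proof -
  have "uniformly_continuous_on (tube x) D"
    by (intro compact_uniformly_continuous compact_tube assms(1)
        continuous_on_subset[OF cont tube_subset])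
  then obtain d where d: "0 < d"
    "\<And>z z'. z \<in> tube x \<Longrightarrow> z' \<in> tube x \<Longrightarrow> dist z' z < d \<Longrightarrow> dist (D z') (D z) < e"
    using \<open>0 < e\<close> unfolding uniformly_continuous_on_def by metis
  have "norm (v (x \<tau> + \<eta>) \<tau> - v (x \<tau>) \<tau> - D (x \<tau>, \<tau>) \<eta>) \<le> e * norm \<eta>"
    if \<tau>: "\<tau> \<in> {0..t}" and \<eta>: "norm \<eta> < min d 1" for \<tau> \<eta>
  proof -
    \<comment> \<open>The cap 1 on the radius keeps this ball inside the tube.\<close>
    define B where "B = ball (x \<tau>) (min d 1)"
    have B: "x \<tau> \<in> B" "x \<tau> + \<eta> \<in> B"
      using \<eta> \<open>0 < d\<close> by (auto simp: B_def dist_norm)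
    have "norm (v (x \<tau> + \<eta>) \<tau> - v (x \<tau>) \<tau> - D (x \<tau>, \<tau>) ((x \<tau> + \<eta>) - x \<tau>))
        \<le> norm ((x \<tau> + \<eta>) - x \<tau>) * e"
    proof (rule differentiable_bound_linearization[of _ _ B "\<lambda>y. v y \<tau>" "\<lambda>y. D (y, \<tau>)"])
      show "x \<tau> + r *\<^sub>R (x \<tau> + \<eta> - x \<tau>) \<in> B" if r: "r \<in> {0..1}" for r
      proof -
        have "\<bar>r\<bar> * norm \<eta> \<le> 1 * norm \<eta>"
          using r by (intro mult_right_mono) auto
        then show ?thesis using \<eta> by (simp add: B_def dist_norm)
      qed
      show "((\<lambda>y. v y \<tau>) has_derivative D (y, \<tau>)) (at y within B)" for y
        by (rule has_derivative_at_withinI[OF deriv[OF \<tau>]])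
      show "onorm (blinfun_apply (D (y, \<tau>)) - blinfun_apply (D (x \<tau>, \<tau>))) \<le> e" if "y \<in> B" for y
      proof -
        have "norm (y - x \<tau>) < d" "norm (y - x \<tau>) \<le> 1"
          using that by (auto simp: B_def dist_norm norm_minus_commute)
        then have "dist (D (y, \<tau>)) (D (x \<tau>, \<tau>)) < e"
          by (intro d(2) tubeI \<tau>) (auto simp: dist_Pair_Pair dist_norm)
        then show ?thesis
          by (simp add: dist_norm norm_blinfun.rep_eq minus_blinfun.rep_eq fun_diff_def)
      qed
    qed (use B in auto)
    then show ?thesis by (simp add: mult.commute)
  qed
  then show thesis using that \<open>0 < d\<close> by (metis min_less_iff_conj zero_less_one)
qed

text \<open>The difference of two trajectories obeys a linear growth bound while it stays in the
  unit ball, so the continuity argument applies with \<open>C = exp (L * t)\<close>. This constant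
  is the same for all \<open>y\<close>.\<close>

lemma flow_lipschitz:
  assumes x: "\<And>\<tau>. \<tau> \<in> {0..t} \<Longrightarrow> (x has_vector_derivative v (x \<tau>) \<tau>) (at \<tau> within {0..t})"
  obtains C where "0 < C"
    "\<And>y \<tau>. (\<And>\<tau>. \<tau> \<in> {0..t} \<Longrightarrow> (y has_vector_derivative v (y \<tau>) \<tau>) (at \<tau> within {0..t})) \<Longrightarrow>
      C * norm (y 0 - x 0) < 1 \<Longrightarrow> \<tau> \<in> {0..t} \<Longrightarrow> norm (y \<tau> - x \<tau>) \<le> C * norm (y 0 - x 0)"
proof -
  have "continuous_on {0..t} x"
    by (rule continuous_on_vector_derivative[OF x])
  then obtain L where L: "0 \<le> L"
    "\<And>\<tau> \<eta>. \<tau> \<in> {0..t} \<Longrightarrow> norm \<eta> \<le> 1 \<Longrightarrow> norm (v (x \<tau> + \<eta>) \<tau> - v (x \<tau>) \<tau>) \<le> L * norm \<eta>"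
    using lipschitz_on_tube by blast
  show thesis
  proof (rule that[of "exp (L * t)"])
    fix y \<tau>
    assume y: "\<And>\<tau>. \<tau> \<in> {0..t} \<Longrightarrow> (y has_vector_derivative v (y \<tau>) \<tau>) (at \<tau> within {0..t})"
      and small: "exp (L * t) * norm (y 0 - x 0) < 1" and \<tau>: "\<tau> \<in> {0..t}"
    show "norm (y \<tau> - x \<tau>) \<le> exp (L * t) * norm (y 0 - x 0)"
    proof (rule norm_le_exp_growth_local[of t "\<lambda>\<tau>. y \<tau> - x \<tau>" "\<lambda>\<tau>. v (y \<tau>) \<tau> - v (x \<tau>) \<tau>"])
      show "norm (v (y \<tau>) \<tau> - v (x \<tau>) \<tau>) \<le> L * norm (y \<tau> - x \<tau>)"
        if "\<tau> \<in> {0..t}" "norm (y \<tau> - x \<tau>) \<le> 1" for \<tau>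
        using L(2)[OF that] by simp
    qed (use x y L \<tau> small in \<open>auto intro: has_vector_derivative_diff\<close>)
  qed simp
qed

end

subsection \<open>Area preservation\<close>

text \<open>The determinant of the matrix with columns \<open>u\<close> and \<open>w\<close>, that
  is, the signed area they span.\<close>

definition cross2 :: "real^2 \<Rightarrow> real^2 \<Rightarrow> real" where
  "cross2 u w = u $ 1 * w $ 2 - u $ 2 * w $ 1"

lemma abs_cross2_le: "\<bar>cross2 u w\<bar> \<le> 2 * (norm u * norm w)"
proof -
  have "\<bar>cross2 u w\<bar> \<le> \<bar>u $ 1\<bar> * \<bar>w $ 2\<bar> + \<bar>u $ 2\<bar> * \<bar>w $ 1\<bar>"
    unfolding cross2_def by (rule order_trans[OF abs_triangle_ineq4]) (simp add: abs_mult)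
  also have "\<dots> \<le> norm u * norm w + norm u * norm w"
    by (intro add_mono mult_mono component_le_norm_cart) auto
  finally show ?thesis by simp
qed

lemma bounded_bilinear_cross2: "bounded_bilinear cross2"
proof
  show "\<exists>K. \<forall>a b. norm (cross2 a b) \<le> norm a * norm b * K"
    using abs_cross2_le by (intro exI[of _ 2]) (simp add: mult.commute)
qed (simp_all add: cross2_def algebra_simps)

lemma linear_vec2_expand:
  assumes "linear (B :: real^2 \<Rightarrow> real^2)"
  shows "B u = u $ 1 *\<^sub>R B (axis 1 1) + u $ 2 *\<^sub>R B (axis 2 1)"
proof -
  interpret linear B by (rule assms)
  have "B (u $ 1 *\<^sub>R axis 1 1 + u $ 2 *\<^sub>R axis 2 1) =
      u $ 1 *\<^sub>R B (axis 1 1) + u $ 2 *\<^sub>R B (axis 2 1)"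
    by (simp only: add scale)
  moreover have "u $ 1 *\<^sub>R axis 1 1 + u $ 2 *\<^sub>R axis 2 1 = u"
    by (simp add: vec_eq_iff forall_2 axis_def)
  ultimately show ?thesis by simp
qed

text \<open>The infinitesimal form of the product rule for determinants: moving both vectors by
  \<open>B\<close> changes their area at the rate of the trace of \<open>B\<close>. For a velocity
  gradient that trace is the divergence.\<close>

lemma cross2_linear_trace:
  assumes "linear (B :: real^2 \<Rightarrow> real^2)"
  shows "cross2 (B u) w + cross2 u (B w) = (B (axis 1 1) $ 1 + B (axis 2 1) $ 2) * cross2 u w"
  by (simp add: linear_vec2_expand[OF assms, of u] linear_vec2_expand[OF assms, of w] cross2_def
      algebra_simps)

lemma has_derivative_directional_limit:
  fixes f :: "'a::real_normed_vector \<Rightarrow> 'b::real_normed_vector"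
  assumes "(f has_derivative A) (at a)"
  shows "((\<lambda>e. (f (a + e *\<^sub>R h) - f a) /\<^sub>R e) \<longlongrightarrow> A h) (at_right 0)"
proof -
  interpret bounded_linear A using assms has_derivative_bounded_linear by blast
  have "((\<lambda>e. f (a + e *\<^sub>R h)) has_derivative (\<lambda>r. A (r *\<^sub>R h))) (at 0 within {0<..})"
    by (rule has_derivative_compose[of _ _ _ _ f]) (auto intro!: derivative_eq_intros simp: assms)
  then have "((\<lambda>e. (f (a + e *\<^sub>R h) - f a - A (e *\<^sub>R h)) /\<^sub>R norm e) \<longlongrightarrow> 0) (at_right 0)"
    by (simp add: has_derivative_at_within)
  then have "((\<lambda>e. (f (a + e *\<^sub>R h) - f a - A (e *\<^sub>R h)) /\<^sub>R norm e + A h) \<longlongrightarrow> 0 + A h) (at_right 0)"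
    by (intro tendsto_intros)
  then have "((\<lambda>e. (f (a + e *\<^sub>R h) - f a - A (e *\<^sub>R h)) /\<^sub>R norm e + A h) \<longlongrightarrow> A h) (at_right 0)"
    by simp
  then show ?thesis
  proof (rule Lim_transform_eventually)
    \<comment> \<open>On the right of 0 the weight \<open>norm e\<close> is \<open>e\<close>, and by
      linearity the subtracted term cancels against \<open>A h\<close>.\<close>
    show "\<forall>\<^sub>F e in at_right 0. (f (a + e *\<^sub>R h) - f a - A (e *\<^sub>R h)) /\<^sub>R norm e + A h =
        (f (a + e *\<^sub>R h) - f a) /\<^sub>R e"
      by (rule eventually_mono[OF eventually_at_right_less[of 0]])
        (simp add: scaleR scaleR_diff_right)
  qed
qed

text \<open>Nothing is assumed about the dependence of the flow on time and initial point jointly, so the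
  variational equation for the Jacobian matrix is not available.  Instead the determinant of the
  difference quotients of size \<open>e\<close> is differentiated in time; its derivative is the divergence
  term, which vanishes, plus an error that tends to 0 with \<open>e\<close>.\<close>

lemma flow_area_preserving:
  fixes v X :: "real^2 \<Rightarrow> real \<Rightarrow> real^2"
  assumes "C1_field v D t" and "0 \<le> t"
    and div0: "\<And>x \<tau>. \<tau> \<in> {0..t} \<Longrightarrow> D (x, \<tau>) (axis 1 1) $ 1 + D (x, \<tau>) (axis 2 1) $ 2 = 0"
    and X0: "\<And>a. X a 0 = a"
    and X: "\<And>a \<tau>. \<tau> \<in> {0..t} \<Longrightarrow> (X a has_vector_derivative v (X a \<tau>) \<tau>) (at \<tau> within {0..t})"
    and A: "((\<lambda>a. X a t) has_derivative A) (at a)"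
  shows "cross2 (A (axis 1 1)) (A (axis 2 1)) = 1"
proof -
  interpret C1_field v D t by fact
  interpret cross2: bounded_bilinear cross2 by (rule bounded_bilinear_cross2)
  obtain C where C: "0 < C"
    "\<And>y \<tau>. (\<And>\<tau>. \<tau> \<in> {0..t} \<Longrightarrow> (y has_vector_derivative v (y \<tau>) \<tau>) (at \<tau> within {0..t})) \<Longrightarrow>
      C * norm (y 0 - X a 0) < 1 \<Longrightarrow> \<tau> \<in> {0..t} \<Longrightarrow> norm (y \<tau> - X a \<tau>) \<le> C * norm (y 0 - X a 0)"
    using flow_lipschitz[of "X a", OF X] by blast
  have contX: "continuous_on {0..t} (X a)"
    by (rule continuous_on_vector_derivative[OF X])
  define \<delta> where "\<delta> e i \<tau> = X (a + e *\<^sub>R axis i 1) \<tau> - X a \<tau>" for e :: real and i :: 2 and \<tau>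
  define \<delta>' where "\<delta>' e i \<tau> = v (X (a + e *\<^sub>R axis i 1) \<tau>) \<tau> - v (X a \<tau>) \<tau>" for e :: real and i :: 2 and \<tau>
  have d\<delta>: "(\<delta> e i has_vector_derivative \<delta>' e i \<tau>) (at \<tau> within {0..t})" if "\<tau> \<in> {0..t}" for e i \<tau>
    unfolding \<delta>_def \<delta>'_def by (intro has_vector_derivative_diff X that)
  have \<delta>0: "\<delta> e i 0 = e *\<^sub>R axis i 1" for e i
    by (simp add: \<delta>_def X0)
  have \<delta>_le: "norm (\<delta> e i \<tau>) \<le> C * e" if "0 < e" "C * e < 1" "\<tau> \<in> {0..t}" for e i \<tau>
    using C(2)[of "X (a + e *\<^sub>R axis i 1)" \<tau>, OF X] that by (simp add: \<delta>_def X0)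
  \<comment> \<open>The area spanned by the two difference quotients; it tends to the Jacobian
    determinant as \<open>e\<close> decreases to 0.\<close>
  define Q where "Q e = cross2 (\<delta> e 1 t /\<^sub>R e) (\<delta> e 2 t /\<^sub>R e)" for e
  have Q_lim: "(Q \<longlongrightarrow> cross2 (A (axis 1 1)) (A (axis 2 1))) (at_right 0)"
    unfolding Q_def \<delta>_def by (intro cross2.tendsto has_derivative_directional_limit A)
  have close: "\<bar>cross2 (A (axis 1 1)) (A (axis 2 1)) - 1\<bar> \<le> \<eta> * (4 * C\<^sup>2 * t)" if \<eta>: "0 < \<eta>" for \<eta>
  proof -
    obtain d where d: "0 < d" "\<And>\<tau> z. \<tau> \<in> {0..t} \<Longrightarrow> norm z < d \<Longrightarrow>
      norm (v (X a \<tau> + z) \<tau> - v (X a \<tau>) \<tau> - D (X a \<tau>, \<tau>) z) \<le> \<eta> * norm z"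
      using uniform_linearization[OF contX \<eta>] by blast
    \<comment> \<open>The bound on \<open>e\<close> serves twice: \<open>C * e < 1\<close> is the
      smallness required for \<open>\<delta>_le\<close>, and \<open>C * e < d\<close> puts the
      separations in the range of the linearization.\<close>
    have bound: "\<bar>Q e - 1\<bar> \<le> \<eta> * (4 * C\<^sup>2 * t)" if e: "0 < e" "e < min d 1 / C" for e
    proof -
      have Ce: "C * e < 1" "C * e < d"
        using e C(1) by (auto simp: field_simps)
      define r where "r i \<tau> = \<delta>' e i \<tau> - D (X a \<tau>, \<tau>) (\<delta> e i \<tau>)" for i \<tau>
      have r: "norm (r i \<tau>) \<le> \<eta> * (C * e)" if \<tau>: "\<tau> \<in> {0..t}" for i \<tau>
      proof -
        have "norm (r i \<tau>) \<le> \<eta> * norm (\<delta> e i \<tau>)"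
          using d(2)[OF \<tau>, of "\<delta> e i \<tau>"] \<delta>_le[OF e(1) Ce(1) \<tau>, of i] Ce(2)
          by (simp add: r_def \<delta>_def \<delta>'_def)
        also have "\<dots> \<le> \<eta> * (C * e)"
          by (intro mult_left_mono \<delta>_le e Ce \<tau>) (use \<eta> in auto)
        finally show ?thesis .
      qed
      define c' where "c' \<tau> = cross2 (\<delta> e 1 \<tau>) (\<delta>' e 2 \<tau>) + cross2 (\<delta>' e 1 \<tau>) (\<delta> e 2 \<tau>)" for \<tau>
      have dc: "((\<lambda>\<tau>. cross2 (\<delta> e 1 \<tau>) (\<delta> e 2 \<tau>)) has_vector_derivative c' \<tau>) (at \<tau> within {0..t})"
        if "\<tau> \<in> {0..t}" for \<tau>
        unfolding c'_def by (intro cross2.has_vector_derivative d\<delta> that)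
      have c'_le: "norm (c' \<tau>) \<le> 4 * \<eta> * (C * e)\<^sup>2" if \<tau>: "\<tau> \<in> {0..t}" for \<tau>
      proof -
        let ?B = "D (X a \<tau>, \<tau>)"
        have "\<delta>' e i \<tau> = ?B (\<delta> e i \<tau>) + r i \<tau>" for i
          by (simp add: r_def)
        then have "c' \<tau> = (cross2 (?B (\<delta> e 1 \<tau>)) (\<delta> e 2 \<tau>) + cross2 (\<delta> e 1 \<tau>) (?B (\<delta> e 2 \<tau>)))
            + (cross2 (\<delta> e 1 \<tau>) (r 2 \<tau>) + cross2 (r 1 \<tau>) (\<delta> e 2 \<tau>))"
          by (simp add: c'_def cross2.add_left cross2.add_right)
        \<comment> \<open>The linear part contributes the trace of the velocity gradient, which is
          zero; only products with the remainders are left.\<close>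
        also have "cross2 (?B (\<delta> e 1 \<tau>)) (\<delta> e 2 \<tau>) + cross2 (\<delta> e 1 \<tau>) (?B (\<delta> e 2 \<tau>)) = 0"
          using div0[OF \<tau>] cross2_linear_trace[OF bounded_linear.linear[OF blinfun.bounded_linear_right]]
          by simp
        finally have "norm (c' \<tau>) \<le> \<bar>cross2 (\<delta> e 1 \<tau>) (r 2 \<tau>)\<bar> + \<bar>cross2 (r 1 \<tau>) (\<delta> e 2 \<tau>)\<bar>"
          by simp
        also have "\<dots> \<le> 2 * (norm (\<delta> e 1 \<tau>) * norm (r 2 \<tau>)) + 2 * (norm (r 1 \<tau>) * norm (\<delta> e 2 \<tau>))"
          by (intro add_mono abs_cross2_le)
        also have "\<dots> \<le> 2 * ((C * e) * (\<eta> * (C * e))) + 2 * ((\<eta> * (C * e)) * (C * e))"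
          by (intro add_mono mult_left_mono mult_mono \<delta>_le r e Ce \<tau>)
            (use e C(1) \<eta> in auto)
        finally show ?thesis by (simp add: power2_eq_square algebra_simps)
      qed
      \<comment> \<open>The error is of order \<open>\<eta> * e\<^sup>2\<close>, and so of order
        \<open>\<eta>\<close> after division by the initial area \<open>e\<^sup>2\<close>.\<close>
      have "norm (cross2 (\<delta> e 1 t) (\<delta> e 2 t) - cross2 (\<delta> e 1 0) (\<delta> e 2 0))
          \<le> 4 * \<eta> * (C * e)\<^sup>2 * norm (t - 0)"
      proof (rule differentiable_bound[of "{0..t}" _ "\<lambda>\<tau> h. h *\<^sub>R c' \<tau>"])
        show "((\<lambda>\<tau>. cross2 (\<delta> e 1 \<tau>) (\<delta> e 2 \<tau>)) has_derivative (\<lambda>h. h *\<^sub>R c' \<tau>)) (at \<tau> within {0..t})"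
          if "\<tau> \<in> {0..t}" for \<tau>
          using dc[OF that] by (simp add: has_vector_derivative_def)
        show "onorm (\<lambda>h. h *\<^sub>R c' \<tau>) \<le> 4 * \<eta> * (C * e)\<^sup>2" if "\<tau> \<in> {0..t}" for \<tau>
          using c'_le[OF that] by (intro onorm_le) (simp add: abs_mult mult.commute mult_left_mono)
      qed (use \<open>0 \<le> t\<close> in auto)
      moreover have "cross2 (\<delta> e 1 0) (\<delta> e 2 0) = e\<^sup>2"
        by (simp add: \<delta>0 cross2_def axis_def power2_eq_square)
      ultimately have le: "\<bar>cross2 (\<delta> e 1 t) (\<delta> e 2 t) - e\<^sup>2\<bar> \<le> \<eta> * (4 * C\<^sup>2 * t) * e\<^sup>2"
        using \<open>0 \<le> t\<close> by (simp add: power_mult_distrib mult_ac)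
      have "Q e - 1 = (cross2 (\<delta> e 1 t) (\<delta> e 2 t) - e\<^sup>2) / e\<^sup>2"
        using e(1) by (simp add: Q_def cross2.scaleR_left cross2.scaleR_right field_simps power2_eq_square)
      then show ?thesis
        using le e(1) by (simp add: abs_divide pos_divide_le_eq)
    qed
    have "0 < min d 1 / C" using d(1) C(1) by simp
    then have "\<forall>\<^sub>F e in at_right 0. \<bar>Q e - 1\<bar> \<le> \<eta> * (4 * C\<^sup>2 * t)"
      using bound by (intro eventually_at_rightI[of 0 "min d 1 / C"]) auto
    moreover have "((\<lambda>e. \<bar>Q e - 1\<bar>) \<longlongrightarrow> \<bar>cross2 (A (axis 1 1)) (A (axis 2 1)) - 1\<bar>) (at_right 0)"
      by (intro tendsto_intros Q_lim)
    ultimately show ?thesis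
      by (intro tendsto_upperbound) auto
  qed
  have "\<bar>cross2 (A (axis 1 1)) (A (axis 2 1)) - 1\<bar> \<le> 0"
  proof (rule field_le_epsilon)
    fix \<epsilon> :: real assume "0 < \<epsilon>"
    \<comment> \<open>The summand 1 keeps the denominator positive also when
      \<open>t = 0\<close>.\<close>
    let ?K = "4 * C\<^sup>2 * t + 1"
    have K: "0 < ?K" using \<open>0 \<le> t\<close> by (simp add: add_nonneg_pos)
    have "\<bar>cross2 (A (axis 1 1)) (A (axis 2 1)) - 1\<bar> \<le> \<epsilon> / ?K * (4 * C\<^sup>2 * t)"
      by (rule close) (use \<open>0 < \<epsilon>\<close> K in simp)
    also have "\<dots> \<le> \<epsilon> / ?K * ?K"
      using \<open>0 < \<epsilon>\<close> K by (intro mult_left_mono) auto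
    also have "\<dots> = 0 + \<epsilon>" using K by simp
    finally show "\<bar>cross2 (A (axis 1 1)) (A (axis 2 1)) - 1\<bar> \<le> 0 + \<epsilon>" .
  qed
  then show ?thesis by simp
qed

subsection \<open>Transport by the quasi-geostrophic flow\<close>

text \<open>An interval with interior points has no isolated points, endpoints included. Hence
  derivatives within it are unique and \<open>vector_derivative\<close> is well determined
  there.\<close>

lemma is_interval_at_within_neq_bot:
  fixes I :: "real set"
  assumes "is_interval I" "interior I \<noteq> {}" "s \<in> I"
  shows "at s within I \<noteq> bot"
proof -
  have "I \<noteq> {x}" for x
    using assms(2) by auto
  then have "s islimpt I"
    using assms(1,3) by (intro connected_imp_perfect) (auto intro: is_interval_connected)
  then show ?thesis
    by (simp add: trivial_limit_within)
qed

section \<open>The time domain as a nondegenerate interval\<close>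

lemma is_interval_time_dom: "is_interval (time_dom T)"
  unfolding is_interval_1 time_dom_def
  by (auto intro: le_less_trans[OF iffD2[OF ereal_less_eq(3)]])

lemma atLeastAtMost_subset_time_dom: "t \<in> time_dom T \<Longrightarrow> {0..t} \<subseteq> time_dom T"
  unfolding time_dom_def by (auto intro: le_less_trans[OF iffD2[OF ereal_less_eq(3)]])

lemma interior_time_dom:
  assumes "0 < T"
  shows "interior (time_dom T) \<noteq> {}"
proof -
  obtain r where r: "0 < ereal r" "ereal r < T"
    using ereal_dense2[OF assms] by auto
  have "{0<..<r} \<subseteq> time_dom T"
    using r by (auto simp: time_dom_def intro: less_trans[of _ "ereal r"])
  then have "{0<..<r} \<subseteq> interior (time_dom T)"
    by (simp add: interior_maximal)
  moreover have "{0<..<r} \<noteq> {}"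
    using r by simp
  ultimately show ?thesis by blast
qed

text \<open>The slice at time \<open>t\<close> lies in the slab, so restriction gives a full
  derivative in space even when \<open>t\<close> is a boundary point of \<open>J\<close>.\<close>

lemma has_derivative_space_slice:
  assumes "(F has_derivative F') (at (x, t) within UNIV \<times> J)" "t \<in> J"
  shows "((\<lambda>y. F (y, t)) has_derivative (\<lambda>h. F' (h, 0))) (at x)"
proof -
  have 1: "((\<lambda>y. (y, t)) has_derivative (\<lambda>h. (h, 0))) (at x)"
    by (auto intro!: derivative_eq_intros)
  have 2: "(F has_derivative F') (at (x, t) within range (\<lambda>y. (y, t)))"
    by (rule has_derivative_subset[OF assms(1)]) (use assms(2) in auto)
  show ?thesis
    using has_derivative_in_compose[OF 1 2] .
qed

text \<open>The material derivative: the graph of \<open>x\<close> moves with velocity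
  \<open>(x', 1)\<close> in space-time and stays in the slab.\<close>

lemma has_derivative_along_graph:
  assumes "(F has_derivative F') (at (x t, t) within UNIV \<times> J)"
    and "(x has_vector_derivative x') (at t within J)"
  shows "((\<lambda>\<tau>. F (x \<tau>, \<tau>)) has_vector_derivative F' (x', 1)) (at t within J)"
proof -
  interpret bounded_linear F' using assms(1) has_derivative_bounded_linear by blast
  have "((\<lambda>\<tau>. F (x \<tau>, \<tau>)) has_derivative (\<lambda>h. F' (h *\<^sub>R x', h))) (at t within J)"
  proof -
    have 1: "((\<lambda>\<tau>. (x \<tau>, \<tau>)) has_derivative (\<lambda>h. (h *\<^sub>R x', h))) (at t within J)"
      using assms(2) by (auto intro!: derivative_eq_intros simp: has_vector_derivative_def)
    have 2: "(F has_derivative F') (at (x t, t) within (\<lambda>\<tau>. (x \<tau>, \<tau>)) ` J)"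
      by (rule has_derivative_subset[OF assms(1)]) auto
    show ?thesis
      using has_derivative_in_compose[OF 1 2] .
  qed
  moreover have "F' (h *\<^sub>R x', h) = h *\<^sub>R F' (x', 1)" for h
    using scaleR[of h "(x', 1)"] by simp
  ultimately show ?thesis by (simp add: has_vector_derivative_def)
qed

section \<open>Gradients and perpendicular gradients in the plane\<close>

lemma partial_eq:
  assumes "(f has_derivative f') (at x)"
  shows "partial i f x = f' (axis i 1)"
  unfolding partial_def using frechet_derivative_at[OF assms] by simp

lemma has_derivative_eq_inner_grad:
  assumes "(f has_derivative f') (at x)"
  shows "f' h = h \<bullet> grad f x"
proof -
  interpret bounded_linear f' using assms has_derivative_bounded_linear by blast
  have "f' (h $ 1 *\<^sub>R axis 1 1 + h $ 2 *\<^sub>R axis 2 1) = h \<bullet> grad f x"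
    by (simp only: add scaleR) (simp add: grad_def partial_eq[OF assms] inner_vec_def sum_2)
  moreover have "h $ 1 *\<^sub>R axis 1 1 + h $ 2 *\<^sub>R axis 2 1 = h"
    by (simp add: vec_eq_iff forall_2 axis_def)
  ultimately show ?thesis by simp
qed

lemma perp_grad_eq: "perp_grad f x = vector [- (grad f x $ 2), grad f x $ 1]"
  by (simp add: perp_grad_def grad_def)

text \<open>The gradient of the composite is the transpose of \<open>A\<close> applied to
  \<open>grad f (\<Phi> a)\<close>; the rest is the planar identity
  \<open>A J A^T = (det A) J\<close>, checked in coordinates.\<close>

lemma perp_grad_pushforward:
  assumes f: "(f has_derivative f') (at (\<Phi> a))" and \<Phi>: "(\<Phi> has_derivative A) (at a)"
  shows "A (perp_grad (\<lambda>x. f (\<Phi> x)) a) =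
    cross2 (A (axis 1 1)) (A (axis 2 1)) *\<^sub>R perp_grad f (\<Phi> a)"
proof -
  have "((\<lambda>x. f (\<Phi> x)) has_derivative (\<lambda>h. f' (A h))) (at a)"
    by (rule has_derivative_compose[OF \<Phi> f])
  from partial_eq[OF this] have "partial i (\<lambda>x. f (\<Phi> x)) a = A (axis i 1) \<bullet> grad f (\<Phi> a)" for i
    by (simp add: has_derivative_eq_inner_grad[OF f])
  then have eq: "perp_grad (\<lambda>x. f (\<Phi> x)) a =
      vector [- (A (axis 2 1) \<bullet> grad f (\<Phi> a)), A (axis 1 1) \<bullet> grad f (\<Phi> a)]"
    by (simp add: perp_grad_def)
  show ?thesis
    unfolding linear_vec2_expand[OF has_derivative_linear[OF \<Phi>], of "perp_grad (\<lambda>x. f (\<Phi> x)) a"]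
    by (simp add: eq perp_grad_eq[of f] vec_eq_iff forall_2 inner_vec_def sum_2 cross2_def algebra_simps)
qed

lemma perp_grad_zero_iff: "perp_grad f x = 0 \<longleftrightarrow> grad f x = 0"
  by (auto simp: perp_grad_def grad_def vec_eq_iff forall_2)

text \<open>\<open>\<psi>\<close> is a stream function. Its first partials are, up to sign, the
  components of \<open>v\<close>, so they inherit a derivative continuous at \<open>x\<close>, and
  vanishing divergence is equality of the mixed derivatives of \<open>\<psi>\<close>.\<close>

lemma perp_grad_velocity_divergence_free:
  fixes v :: "real^2 \<Rightarrow> real^2"
  assumes \<psi>: "\<And>x. \<psi> differentiable (at x)"
    and v: "\<And>x. v x = - perp_grad \<psi> x"
    and D: "\<And>x. (v has_derivative blinfun_apply (D x)) (at x)"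
    and cont: "isCont D x"
  shows "D x (axis 1 1) $ 1 + D x (axis 2 1) $ 2 = 0"
proof -
  let ?f' = "\<lambda>y. frechet_derivative \<psi> (at y)"
  have p: "?f' y (axis 1 1) = - (v y $ 2)" and q: "?f' y (axis 2 1) = v y $ 1" for y
    by (simp_all add: v perp_grad_def partial_def)
  have "- (D x (axis 2 1) $ 2) = D x (axis 1 1) $ 1"
  proof (rule mixed_derivatives_commute[of \<psi> ?f' "axis 1 1" "\<lambda>y h. - (D y h $ 2)" "axis 2 1"
        "\<lambda>y h. D y h $ 1"])
    show "(\<psi> has_derivative ?f' y) (at y)" for y
      using \<psi> frechet_derivative_works by blast
    show "((\<lambda>y. ?f' y (axis 1 1)) has_derivative (\<lambda>h. - (D y h $ 2))) (at y)" for y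
      unfolding p by (intro has_derivative_minus bounded_linear.has_derivative[OF bounded_linear_vec_nth] D)
    show "((\<lambda>y. ?f' y (axis 2 1)) has_derivative (\<lambda>h. D y h $ 1)) (at y)" for y
      unfolding q by (intro bounded_linear.has_derivative[OF bounded_linear_vec_nth] D)
  qed (intro continuous_intros cont)+
  then show ?thesis by simp
qed

text \<open>Smoothness as defined yields continuity of the derivative in each fixed direction; in
  finite dimension this amounts to continuity in the operator norm.\<close>

lemma smooth_on_space_derivative:
  fixes f :: "'a::euclidean_space \<Rightarrow> real \<Rightarrow> 'b::real_normed_vector"
  assumes "smooth_on (UNIV \<times> J) (\<lambda>(x, t). f x t)"
  obtains D where "\<And>x t. t \<in> J \<Longrightarrow> ((\<lambda>y. f y t) has_derivative blinfun_apply (D (x, t))) (at x)"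
    and "continuous_on (UNIV \<times> J) D"
proof -
  have "Ck_on (Suc 0) (UNIV \<times> J) (\<lambda>(x, t). f x t)"
    using assms unfolding smooth_on_def by blast
  then obtain F' where F':
    "\<And>z. z \<in> UNIV \<times> J \<Longrightarrow> ((\<lambda>(x, t). f x t) has_derivative F' z) (at z within UNIV \<times> J)"
    and "\<And>h. Ck_on 0 (UNIV \<times> J) (\<lambda>z. F' z h)"
    by (rule Ck_on_SucE) blast
  then have cont: "continuous_on (UNIV \<times> J) (\<lambda>z. F' z h)" for h
    by simp
  define D where "D z = Blinfun (\<lambda>h. F' z (h, 0))" for z
  have slice: "((\<lambda>y. f y t) has_derivative (\<lambda>h. F' (x, t) (h, 0))) (at x)" if "t \<in> J" for x t
    using has_derivative_space_slice[OF F'[of "(x, t)"]] that by simp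
  have D: "blinfun_apply (D (x, t)) = (\<lambda>h. F' (x, t) (h, 0))" if "t \<in> J" for x t
    unfolding D_def using slice[OF that] by (intro bounded_linear_Blinfun_apply has_derivative_bounded_linear)
  show thesis
  proof (rule that)
    show "((\<lambda>y. f y t) has_derivative blinfun_apply (D (x, t))) (at x)" if "t \<in> J" for x t
      using slice[OF that] D[OF that] by simp
    show "continuous_on (UNIV \<times> J) D"
    proof (rule continuous_on_blinfun_componentwise)
      show "continuous_on (UNIV \<times> J) (\<lambda>z. D z i)" for i
        using cont[of "(i, 0)"] by (rule continuous_on_eq) (auto simp: D)
    qed
  qed
qed

text \<open>Along a trajectory the total time derivative of \<open>\<theta>\<close> is the left-hand
  side of the transport equation, hence zero.\<close>

lemma transported_along_trajectories:
  assumes "0 < T" and sol: "smooth_qg_solution T \<theta>0 \<theta> v" and X: "trajectory_map T v X"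
    and t: "t \<in> time_dom T"
  shows "\<theta> (X a t) t = \<theta>0 a"
proof -
  let ?J = "time_dom T"
  have "Ck_on (Suc 0) (UNIV \<times> ?J) (\<lambda>(x, t). \<theta> x t)"
    using sol unfolding smooth_qg_solution_def smooth_on_def by blast
  then obtain F' where F':
    "\<And>z. z \<in> UNIV \<times> ?J \<Longrightarrow> ((\<lambda>(x, t). \<theta> x t) has_derivative F' z) (at z within UNIV \<times> ?J)"
    by (rule Ck_on_SucE) blast
  have zero: "((\<lambda>\<tau>. \<theta> (X a \<tau>) \<tau>) has_vector_derivative 0) (at \<tau> within ?J)" if \<tau>: "\<tau> \<in> ?J" for \<tau>
  proof -
    let ?x = "X a \<tau>"
    have F: "((\<lambda>(x, t). \<theta> x t) has_derivative F' (?x, \<tau>)) (at (?x, \<tau>) within UNIV \<times> ?J)"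
      using F' \<tau> by blast
    interpret bounded_linear "F' (?x, \<tau>)" using F has_derivative_bounded_linear by blast
    have "((\<lambda>\<tau>. \<theta> ?x \<tau>) has_vector_derivative F' (?x, \<tau>) (0, 1)) (at \<tau> within ?J)"
      using has_derivative_along_graph[where x = "\<lambda>_. ?x", OF F has_vector_derivative_const] by simp
    then have time: "vector_derivative (\<theta> ?x) (at \<tau> within ?J) = F' (?x, \<tau>) (0, 1)"
      by (intro vector_derivative_within is_interval_at_within_neq_bot is_interval_time_dom
          interior_time_dom assms \<tau>)
    have space: "F' (?x, \<tau>) (v ?x \<tau>, 0) = v ?x \<tau> \<bullet> grad (\<lambda>y. \<theta> y \<tau>) ?x"
      using has_derivative_eq_inner_grad[OF has_derivative_space_slice[OF F \<tau>]] by simp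
    \<comment> \<open>Splitting the space-time velocity into its spatial and temporal parts recovers
      the two terms of the equation.\<close>
    have "F' (?x, \<tau>) (v ?x \<tau>, 1) = F' (?x, \<tau>) (v ?x \<tau>, 0) + F' (?x, \<tau>) (0, 1)"
      using add[of "(v ?x \<tau>, 0)" "(0, 1)"] by simp
    also have "\<dots> = vector_derivative (\<theta> ?x) (at \<tau> within ?J) + v ?x \<tau> \<bullet> grad (\<lambda>y. \<theta> y \<tau>) ?x"
      by (simp add: space time)
    also have "\<dots> = 0"
      using sol \<tau> unfolding smooth_qg_solution_def by blast
    finally have "F' (?x, \<tau>) (v ?x \<tau>, 1) = 0" .
    moreover have "(X a has_vector_derivative v ?x \<tau>) (at \<tau> within ?J)"
      using X \<tau> unfolding trajectory_map_def by blast
    ultimately show ?thesis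
      using has_derivative_along_graph[where x = "X a", OF F] by fastforce
  qed
  have "0 \<in> ?J"
    using t atLeastAtMost_subset_time_dom[OF t] by (auto simp: time_dom_def)
  moreover obtain c where "\<And>\<tau>. \<tau> \<in> ?J \<Longrightarrow> \<theta> (X a \<tau>) \<tau> = c"
    using has_vector_derivative_zero_constant[OF is_interval_convex[OF is_interval_time_dom] zero]
    by blast
  ultimately have "\<theta> (X a t) t = \<theta> (X a 0) 0"
    using t by simp
  also have "\<dots> = \<theta>0 a"
    using sol X unfolding smooth_qg_solution_def trajectory_map_def by simp
  finally show ?thesis .
qed

text \<open>At each time \<open>inv_sqrt_laplacian\<close> of \<open>\<theta>\<close> is a stream
  function. Its differentiability is part of the notion of solution, and smoothness of
  \<open>v\<close> supplies its second derivatives.\<close>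

lemma qg_flow_area_preserving:
  assumes sol: "smooth_qg_solution T \<theta>0 \<theta> v" and X: "trajectory_map T v X"
    and t: "t \<in> time_dom T" and A: "((\<lambda>a. X a t) has_derivative A) (at a)"
  shows "cross2 (A (axis 1 1)) (A (axis 2 1)) = 1"
proof -
  let ?J = "time_dom T"
  have sub: "{0..t} \<subseteq> ?J" by (rule atLeastAtMost_subset_time_dom[OF t])
  have "smooth_on (UNIV \<times> ?J) (\<lambda>(x, t). v x t)"
    using sol unfolding smooth_qg_solution_def by blast
  then obtain D where
    D: "\<And>x \<tau>. \<tau> \<in> ?J \<Longrightarrow> ((\<lambda>y. v y \<tau>) has_derivative blinfun_apply (D (x, \<tau>))) (at x)"
    and cont: "continuous_on (UNIV \<times> ?J) D"
    by (rule smooth_on_space_derivative) blast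
  show ?thesis
  proof (rule flow_area_preserving[of v D t X])
    show "C1_field v D t"
      using D sub by unfold_locales (auto intro: continuous_on_subset[OF cont])
    show "0 \<le> t" using t by (simp add: time_dom_def)
    show "D (x, \<tau>) (axis 1 1) $ 1 + D (x, \<tau>) (axis 2 1) $ 2 = 0" if "\<tau> \<in> {0..t}" for x \<tau>
    proof (rule perp_grad_velocity_divergence_free)
      have \<tau>: "\<tau> \<in> ?J" using that sub by blast
      show "inv_sqrt_laplacian (\<lambda>y. \<theta> y \<tau>) differentiable (at x)"
        and "v x \<tau> = - perp_grad (inv_sqrt_laplacian (\<lambda>y. \<theta> y \<tau>)) x" for x
        using sol \<tau> unfolding smooth_qg_solution_def by blast+
      show "((\<lambda>x. v x \<tau>) has_derivative blinfun_apply (D (x, \<tau>))) (at x)" for x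
        by (rule D[OF \<tau>])
      have "continuous_on UNIV (\<lambda>x. D (x, \<tau>))"
        using \<tau> by (intro continuous_on_compose2[OF cont] continuous_intros) auto
      then show "isCont (\<lambda>x. D (x, \<tau>)) x"
        by (simp add: continuous_on_eq_continuous_at)
    qed
    show "X a 0 = a" for a
      using X unfolding trajectory_map_def by blast
    show "(X a has_vector_derivative v (X a \<tau>) \<tau>) (at \<tau> within {0..t})" if "\<tau> \<in> {0..t}" for a \<tau>
      using X sub that unfolding trajectory_map_def
      by (blast intro: has_vector_derivative_within_subset)
  qed (rule A)
qed

section \<open>Level curves carried by the flow and the conserved quotient\<close>

theorem theorem2p2:
  fixes T :: ereal
    and \<theta>0 :: "real^2 \<Rightarrow> real"
    and \<theta> :: "real^2 \<Rightarrow> real \<Rightarrow> real"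
    and v X :: "real^2 \<Rightarrow> real \<Rightarrow> real^2"
    and I :: "real set"
    and \<gamma>0 :: "real \<Rightarrow> real^2"
    and \<gamma> :: "real \<Rightarrow> real \<Rightarrow> real^2"
  assumes "0 < T"
    and "smooth_qg_solution T \<theta>0 \<theta> v"
    and "trajectory_map T v X"
    and "is_interval I" and "interior I \<noteq> {}"
    and "level_curve \<theta>0 I \<gamma>0"
    and "integral_curve (perp_grad \<theta>0) I \<gamma>0"
    and "\<And>s t. \<gamma> s t = X (\<gamma>0 s) t"
  shows "(\<forall>t\<in>time_dom T. level_curve (\<lambda>x. \<theta> x t) I (\<lambda>s. \<gamma> s t)) \<and>
    (\<forall>s\<in>I. \<forall>t\<in>time_dom T.
      norm (perp_grad (\<lambda>x. \<theta> x t) (\<gamma> s t)) / norm (curve_deriv I (\<lambda>s. \<gamma> s t) s) =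
      norm (perp_grad \<theta>0 (\<gamma>0 s)) / norm (curve_deriv I \<gamma>0 s))"
proof (intro conjI ballI)
  fix t assume t: "t \<in> time_dom T"
  have smoothX: "smooth_on UNIV (\<lambda>a. X a t)"
    using assms(3) t unfolding trajectory_map_def diffeomorphism_def by blast
  have smooth\<gamma>: "smooth_on I \<gamma>0" and const: "\<exists>c. \<forall>s\<in>I. \<theta>0 (\<gamma>0 s) = c"
    using assms(6) unfolding level_curve_def by auto
  have transport: "\<theta> (X a t) t = \<theta>0 a" for a
    by (rule transported_along_trajectories[OF assms(1-3) t])
  have "smooth_on I (\<lambda>s. X (\<gamma>0 s) t)"
    using smoothX smooth\<gamma> unfolding smooth_on_def
    by (blast intro: Ck_on_compose[where f = \<gamma>0 and U = UNIV and g = "\<lambda>a. X a t"])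
  then show "level_curve (\<lambda>x. \<theta> x t) I (\<lambda>s. \<gamma> s t)"
    using const unfolding level_curve_def assms(8) transport by blast
  fix s assume s: "s \<in> I"
  let ?a = "\<gamma>0 s" and ?\<theta>t = "\<lambda>x. \<theta> x t"
  have "Ck_on (Suc 0) UNIV (\<lambda>a. X a t)"
    using smoothX unfolding smooth_on_def by blast
  then obtain A where A: "((\<lambda>a. X a t) has_derivative A) (at ?a)"
    by auto
  interpret A: bounded_linear A using A has_derivative_bounded_linear by blast
  have "smooth_on (UNIV \<times> time_dom T) (\<lambda>(x, t). \<theta> x t)"
    using assms(2) unfolding smooth_qg_solution_def by blast
  then obtain \<theta>' where \<theta>': "(?\<theta>t has_derivative \<theta>') (at (X ?a t))"
    using t by (metis smooth_on_space_derivative)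
  \<comment> \<open>The determinant being 1, \<open>A\<close> carries one perpendicular gradient
    exactly to the other, just as it carries the tangent vectors in \<open>deriv\<close>
    below.\<close>
  have push: "A (perp_grad \<theta>0 ?a) = perp_grad ?\<theta>t (X ?a t)"
    using perp_grad_pushforward[OF \<theta>' A] qg_flow_area_preserving[OF assms(2,3) t A]
    by (simp add: transport)
  have nb: "at s within I \<noteq> bot"
    by (rule is_interval_at_within_neq_bot[OF assms(4,5) s])
  have "Ck_on (Suc 0) I \<gamma>0"
    using smooth\<gamma> unfolding smooth_on_def by blast
  then have "\<gamma>0 differentiable (at s within I)"
    using s by (auto simp: differentiable_def)
  then have \<gamma>0': "(\<gamma>0 has_vector_derivative curve_deriv I \<gamma>0 s) (at s within I)"
    unfolding curve_deriv_def by (simp add: vector_derivative_works)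
  have "((\<lambda>s. X (\<gamma>0 s) t) has_vector_derivative A (curve_deriv I \<gamma>0 s)) (at s within I)"
    using vector_derivative_diff_chain_within[OF \<gamma>0' has_derivative_at_withinI[OF A]]
    by (simp add: o_def)
  then have deriv: "curve_deriv I (\<lambda>s. \<gamma> s t) s = A (curve_deriv I \<gamma>0 s)"
    unfolding assms(8) curve_deriv_def[of I "\<lambda>s. X (\<gamma>0 s) t"] by (rule vector_derivative_within[OF nb])
  \<comment> \<open>The tangent vector is nonzero, which forces the perpendicular gradient to be
    nonzero as well.\<close>
  obtain c where c: "c \<noteq> 0" "curve_deriv I \<gamma>0 s = c *\<^sub>R perp_grad \<theta>0 ?a" "perp_grad \<theta>0 ?a \<noteq> 0"
    using assms(7) s unfolding integral_curve_def by force
  \<comment> \<open>Both quotients reduce to \<open>1 / \<bar>c\<bar>\<close> once the norms cancel,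
    which requires a nonzero transported vector: division by zero being 0, the left side would
    otherwise be 0. If it vanished, the chain rule would make the derivative of
    \<open>\<theta>0\<close> at \<open>?a\<close> vanish.\<close>
  have "perp_grad ?\<theta>t (X ?a t) \<noteq> 0"
  proof
    assume "perp_grad ?\<theta>t (X ?a t) = 0"
    then have "\<theta>' h = 0" for h
      by (simp add: has_derivative_eq_inner_grad[OF \<theta>'] perp_grad_zero_iff)
    then have "(\<theta>0 has_derivative (\<lambda>h. 0)) (at ?a)"
      using has_derivative_compose[OF A \<theta>'] by (simp add: transport)
    from partial_eq[OF this] have "perp_grad \<theta>0 ?a = 0"
      by (simp add: perp_grad_def vec_eq_iff forall_2)
    then show False using c(3) by contradiction
  qed
  then show "norm (perp_grad ?\<theta>t (\<gamma> s t)) / norm (curve_deriv I (\<lambda>s. \<gamma> s t) s) =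
      norm (perp_grad \<theta>0 ?a) / norm (curve_deriv I \<gamma>0 s)"
    unfolding deriv c(2) A.scaleR push unfolding assms(8) using c(1,3) by simp
qed

end
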